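(* The univariate polynomial $$f:=\Big(x-\frac12\Big)^4+\frac1{1000}$$ satisfies $f(x)>0$ for $x\in[0,1]$, but it cannot be written in the form $$p_0+x\,p_1+(1-x)\,p_2+x(1-x)\,p_3$$ with (univariate) SONC polynomials $p_0,p_1,p_2$ and $p_3$.
   Context: A univariate polynomial $p\in\mathbb{R}[x]$ is a SONC polynomial if it is a finite sum of polynomials, each non-negative on $\mathbb{R}$ and each of one of the following two types: (i) $\sum_{i\text{ even}}c_ix^i$ (finite sum over even $i\ge0$) with at most one negative coefficient $c_i$; (ii) $\sum_{i\text{ even}}c_ix^i+d\,x^j$ with all $c_i\ge0$, $j$ an odd natural number and $d\in\mathbb{R}$. (Equivalently, in the paper's notation, $p$ lies for some $r\in\mathbb{N}$ in the cone $C_{\mathcal{S}}(\{0,\dots,r\}\cap2\mathbb{N},\{0,\dots,r\}\setminus2\mathbb{N})$ of sums of non-negative AG functions of types (i), (ii) of degree at most $r$.) *)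

theory Defs
  imports "HOL-Analysis.Analysis" "HOL-Computational_Algebra.Polynomial"
begin

definition nonneg_on_reals :: "real poly \<Rightarrow> bool" where
  "nonneg_on_reals p \<longleftrightarrow> (\<forall>x. poly p x \<ge> 0)"

definition even_exponents :: "real poly \<Rightarrow> bool" where
  "even_exponents p \<longleftrightarrow> (\<forall>i. odd i \<longrightarrow> coeff p i = 0)"

(* A polynomial has finitely many nonzero coefficients, so the set below is
   finite and card is the true count. *)
definition even_AG_form :: "real poly \<Rightarrow> bool" where
  "even_AG_form p \<longleftrightarrow> even_exponents p \<and> card {i. coeff p i < 0} \<le> 1"

definition odd_AG_form :: "real poly \<Rightarrow> bool" where
  "odd_AG_form p \<longleftrightarrow>
     (\<exists>q d j. even_exponents q \<and> (\<forall>i. coeff q i \<ge> 0) \<and> odd j \<and> p = q + monom d j)"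

definition SONC :: "real poly \<Rightarrow> bool" where
  "SONC p \<longleftrightarrow>
     (\<exists>gs. (\<forall>g \<in> set gs. nonneg_on_reals g \<and> (even_AG_form g \<or> odd_AG_form g))
         \<and> p = sum_list gs)"

end

theory Submission
  imports Defs
begin

text \<open>
  Every SONC polynomial \<open>p\<close> satisfies \<open>p(0) \<le> 8 p(1/3) + 2 p(2/3)\<close>.  Granting this, evaluate a
  representation \<open>f = p\<^sub>0 + x p\<^sub>1 + (1-x) p\<^sub>2 + x(1-x) p\<^sub>3\<close> at the points \<open>0\<close>, \<open>1/3\<close> and \<open>2/3\<close>.
  All the \<open>p\<^sub>i\<close> are non-negative, so in \<open>12 f(1/3) + 6 f(2/3)\<close> the terms with \<open>p\<^sub>1\<close> and \<open>p\<^sub>3\<close> may be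
  dropped, while \<open>p\<^sub>2\<close> enters with the weights \<open>12 * 2/3 = 8\<close> and \<open>6 * 1/3 = 2\<close>, and \<open>p\<^sub>0\<close> with the
  larger weights \<open>12\<close> and \<open>6\<close>.  Hence \<open>12 f(1/3) + 6 f(2/3) \<ge> p\<^sub>0(0) + p\<^sub>2(0) = f(0)\<close>.  But
  \<open>f(1/3) = f(2/3) = 1/1296 + 1/1000\<close> makes the left side about \<open>0.032\<close>, whereas \<open>f(0)\<close> is
  \<open>0.0635\<close>: the polynomial \<open>f\<close> is too flat around \<open>1/2\<close> for its value at \<open>0\<close>.

  The inequality for SONC polynomials is about the linear functional with value
  \<open>\<phi>(k) = (8 + 2 * 2^k) / 3^k\<close> at \<open>x^k\<close> for \<open>k > 0\<close>, and \<open>\<phi>(0) = 10 - 1 = 9\<close>.  The sequence \<open>\<phi>\<close>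
  is positive and log-convex: away from \<open>k = 0\<close> because it is a moment sequence, and at the start
  because \<open>\<phi>(0) \<phi>(2) = 9 * 16/9 = \<phi>(1)^2\<close>.  A log-convex sequence lies above a geometric one that
  touches it at any prescribed index \<open>b\<close> (lemma \<open>log_convex_geometric_support\<close>).  If \<open>b\<close> is the
  index of the only negative coefficient of \<open>p\<close>, replacing \<open>\<phi>\<close> by this geometric sequence
  decreases the functional to a positive multiple of a value of \<open>p\<close>, which is non-negative.
\<close>

text \<open>
  The ratios \<open>\<phi>(k+1) / \<phi>(k)\<close> increase with \<open>k\<close>; the ratio \<open>r\<close> at \<open>b\<close> therefore bounds the later
  ones from below and the earlier ones from above.
\<close>

lemma log_convex_geometric_support:
  fixes \<phi> :: "nat \<Rightarrow> real"
  assumes pos: "\<And>k. \<phi> k > 0"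
    and log_convex: "\<And>k. \<phi> (Suc k) ^ 2 \<le> \<phi> k * \<phi> (Suc (Suc k))"
  obtains r where "r > 0" "\<And>k. \<phi> b * r ^ k \<le> \<phi> k * r ^ b"
proof -
  define ratio where "ratio k = \<phi> (Suc k) / \<phi> k" for k
  have "ratio k \<le> ratio (Suc k)" for k
    using log_convex[of k] pos[of k] pos[of "Suc k"]
    by (simp add: ratio_def divide_simps power2_eq_square mult.commute)
  then have "mono ratio" by (simp add: mono_iff_le_Suc)
  have step: "\<phi> (Suc k) = ratio k * \<phi> k" for k
    using pos[of k] by (simp add: ratio_def)
  define r where "r = ratio b"
  have "r > 0" using pos by (simp add: r_def ratio_def)
  have above: "\<phi> b * r ^ n \<le> \<phi> (b + n)" for n
  proof (induction n)
    case (Suc n)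
    have "r \<le> ratio (b + n)" using \<open>mono ratio\<close> by (simp add: r_def mono_def)
    then have "r * (\<phi> b * r ^ n) \<le> ratio (b + n) * \<phi> (b + n)"
      using Suc \<open>r > 0\<close> pos[of b] by (intro mult_mono) auto
    then show ?case by (simp add: step mult_ac)
  qed simp
  have below: "\<phi> (k + n) \<le> \<phi> k * r ^ n" if "k + n = b" for k n
    using that
  proof (induction n arbitrary: k)
    case (Suc n)
    have "\<phi> (Suc k + n) \<le> \<phi> (Suc k) * r ^ n" using Suc.IH[of "Suc k"] Suc.prems by simp
    also have "\<phi> (Suc k) \<le> r * \<phi> k"
      using \<open>mono ratio\<close> pos[of k] Suc.prems unfolding step r_def
      by (intro mult_right_mono) (auto simp: mono_def)
    then have "\<phi> (Suc k) * r ^ n \<le> (r * \<phi> k) * r ^ n"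
      using \<open>r > 0\<close> by (intro mult_right_mono) auto
    finally show ?case by (simp add: mult_ac)
  qed simp
  have "\<phi> b * r ^ k \<le> \<phi> k * r ^ b" for k
  proof (cases "b \<le> k")
    case True
    then obtain n where "k = b + n" using le_Suc_ex by blast
    then show ?thesis using mult_right_mono[OF above[of n], of "r ^ b"] \<open>r > 0\<close>
      by (simp add: power_add mult_ac)
  next
    case False
    then obtain n where "b = k + n" using le_Suc_ex nat_le_linear by blast
    then show ?thesis using mult_right_mono[OF below[of k n], of "r ^ k"] \<open>r > 0\<close>
      by (simp add: power_add mult_ac)
  qed
  then show thesis using that \<open>r > 0\<close> by blast
qed

text \<open>
  On the geometric sequence that supports \<open>\<phi>\<close> at \<open>b\<close>, the functional is evaluation at a point
  \<open>r > 0\<close>, up to a positive factor.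
\<close>

lemma log_convex_functional_nonneg:
  fixes \<phi> :: "nat \<Rightarrow> real" and p :: "real poly"
  assumes "\<And>k. \<phi> k > 0" "\<And>k. \<phi> (Suc k) ^ 2 \<le> \<phi> k * \<phi> (Suc (Suc k))"
    and coeffs: "\<And>i. i \<noteq> b \<Longrightarrow> coeff p i \<ge> 0"
    and nonneg: "\<And>x. x > 0 \<Longrightarrow> poly p x \<ge> 0"
  shows "0 \<le> (\<Sum>k\<le>degree p. coeff p k * \<phi> k)"
proof -
  obtain r where r: "r > 0" "\<And>k. \<phi> b * r ^ k \<le> \<phi> k * r ^ b"
    using log_convex_geometric_support[of \<phi> b] assms(1,2) by blast
  \<comment> \<open>At \<open>k = b\<close> the two sides agree, so the sign of that coefficient does not matter.\<close>
  have "coeff p k * (\<phi> b * r ^ k) \<le> coeff p k * (\<phi> k * r ^ b)" for k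
    using r(2)[of k] coeffs[of k] by (cases "k = b") (auto intro: mult_left_mono)
  then have "(\<Sum>k\<le>degree p. coeff p k * (\<phi> b * r ^ k)) \<le> (\<Sum>k\<le>degree p. coeff p k * (\<phi> k * r ^ b))"
    by (rule sum_mono)
  then have "\<phi> b * poly p r \<le> r ^ b * (\<Sum>k\<le>degree p. coeff p k * \<phi> k)"
    by (simp add: poly_altdef sum_distrib_left mult_ac)
  moreover have "0 \<le> \<phi> b * poly p r" using nonneg r(1) assms(1)[of b] by simp
  ultimately show ?thesis using r(1) by (smt (verit) zero_less_power mult_pos_neg)
qed

text \<open>
  The weights \<open>8\<close> and \<open>2\<close> are chosen to make \<open>\<phi>(0) \<phi>(2) = \<phi>(1)^2\<close>, which is the case of
  log-convexity that involves the subtracted value at \<open>0\<close>.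
\<close>

lemma one_neg_coeff_value_at_0_le:
  fixes p :: "real poly"
  assumes coeffs: "\<And>i. i \<noteq> b \<Longrightarrow> coeff p i \<ge> 0" and nonneg: "\<And>x. x > 0 \<Longrightarrow> poly p x \<ge> 0"
  shows "poly p 0 \<le> 8 * poly p (1/3) + 2 * poly p (2/3)"
proof -
  define \<phi> :: "nat \<Rightarrow> real" where
    "\<phi> k = 8 * (1/3) ^ k + 2 * (2/3) ^ k - 0 ^ k" for k
  have "\<phi> k > 0" for k
    by (cases k) (auto simp: \<phi>_def intro!: add_pos_pos)
  moreover have "\<phi> (Suc k) ^ 2 \<le> \<phi> k * \<phi> (Suc (Suc k))" for k
  proof (cases k)
    case 0
    then show ?thesis by (simp add: \<phi>_def power2_eq_square)
  next
    case (Suc n)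
    \<comment> \<open>The difference of the two sides is the Gram determinant \<open>8 * 2 * (1/3)^k * (2/3)^k * (2/3 - 1/3)^2\<close>.\<close>
    define u v :: real where "u = (1/3) ^ k" and "v = (2/3) ^ k"
    have phi_uv: "\<phi> k = 8 * u + 2 * v" "\<phi> (Suc k) = 8/3 * u + 4/3 * v"
      "\<phi> (Suc (Suc k)) = 8/9 * u + 8/9 * v"
      using Suc by (simp_all add: \<phi>_def u_def v_def)
    have "\<phi> k * \<phi> (Suc (Suc k)) - \<phi> (Suc k) ^ 2 = 16/9 * (u * v)"
      unfolding phi_uv by (simp add: field_simps power2_eq_square)
    moreover have "u * v \<ge> 0" by (simp add: u_def v_def)
    ultimately show ?thesis by linarith
  qed
  ultimately have "0 \<le> (\<Sum>k\<le>degree p. coeff p k * \<phi> k)"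
    using log_convex_functional_nonneg[of \<phi> b p] coeffs nonneg by blast
  also have "\<dots> = 8 * poly p (1/3) + 2 * poly p (2/3) - poly p 0"
    unfolding \<phi>_def poly_altdef
    by (simp add: sum_distrib_left sum.distrib sum_subtractf algebra_simps)
  finally show ?thesis by simp
qed

lemma AG_form_one_neg_coeff:
  assumes "even_AG_form g \<or> odd_AG_form g"
  obtains b where "\<And>i. i \<noteq> b \<Longrightarrow> coeff g i \<ge> 0"
  using assms
proof
  assume "even_AG_form g"
  have "finite {i. coeff g i < 0}"
    by (rule finite_subset[of _ "{..degree g}"]) (auto intro: le_degree)
  then have "\<exists>b. {i. coeff g i < 0} \<subseteq> {b}"
    using \<open>even_AG_form g\<close> unfolding even_AG_form_def
    by (metis One_nat_def card_le_Suc0_iff_eq subsetI singleton_iff)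
  then show thesis using that by (metis (mono_tags) linorder_not_less mem_Collect_eq singletonD subsetD)
next
  assume "odd_AG_form g"
  then obtain q d j where "\<And>i. coeff q i \<ge> 0" "g = q + monom d j"
    unfolding odd_AG_form_def by blast
  then show thesis using that[of j] by simp
qed

lemma SONC_nonneg: "SONC p \<Longrightarrow> poly p x \<ge> 0"
proof -
  have "\<forall>g \<in> set gs. poly g x \<ge> 0 \<Longrightarrow> poly (sum_list gs) x \<ge> 0" for gs
    by (induction gs) auto
  then show "SONC p \<Longrightarrow> poly p x \<ge> 0"
    unfolding SONC_def nonneg_on_reals_def by blast
qed

lemma SONC_value_at_0_le:
  assumes "SONC p"
  shows "poly p 0 \<le> 8 * poly p (1/3) + 2 * poly p (2/3)"
proof -
  obtain gs where gs: "p = sum_list gs"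
    "\<And>g. g \<in> set gs \<Longrightarrow> nonneg_on_reals g \<and> (even_AG_form g \<or> odd_AG_form g)"
    using assms unfolding SONC_def by blast
  have "poly g 0 \<le> 8 * poly g (1/3) + 2 * poly g (2/3)" if "g \<in> set gs" for g
    using gs(2)[OF that] AG_form_one_neg_coeff one_neg_coeff_value_at_0_le
    unfolding nonneg_on_reals_def by metis
  then have "poly (sum_list gs) 0 \<le> 8 * poly (sum_list gs) (1/3) + 2 * poly (sum_list gs) (2/3)"
    by (induction gs) (simp_all, smt (verit))
  then show ?thesis using gs(1) by simp
qed

theorem theorem4p11:
  fixes f :: "real poly"
  assumes f_def: "f = [:- 1 / 2, 1:] ^ 4 + [:1 / 1000:]"
  shows "(\<forall>x \<in> {0..1}. poly f x > 0) \<and>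
    \<not> (\<exists>p0 p1 p2 p3. SONC p0 \<and> SONC p1 \<and> SONC p2 \<and> SONC p3 \<and>
         f = p0 + [:0, 1:] * p1 + [:1, - 1:] * p2 + [:0, 1:] * [:1, - 1:] * p3)"
proof (intro conjI notI)
  have f: "poly f x = (x - 1/2) ^ 4 + 1/1000" for x
    by (simp add: f_def)
  show "\<forall>x \<in> {0..1}. poly f x > 0"
    by (auto simp: f intro!: add_nonneg_pos)
  assume "\<exists>p0 p1 p2 p3. SONC p0 \<and> SONC p1 \<and> SONC p2 \<and> SONC p3 \<and>
         f = p0 + [:0, 1:] * p1 + [:1, - 1:] * p2 + [:0, 1:] * [:1, - 1:] * p3"
  then obtain p0 p1 p2 p3 where SONC: "SONC p0" "SONC p1" "SONC p2" "SONC p3"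
    and rep: "f = p0 + [:0, 1:] * p1 + [:1, - 1:] * p2 + [:0, 1:] * [:1, - 1:] * p3"
    by blast
  have eval: "poly f x = poly p0 x + x * poly p1 x + (1 - x) * poly p2 x + x * (1 - x) * poly p3 x"
    for x by (simp add: rep algebra_simps)
  have "poly f 0 = poly p0 0 + poly p2 0"
    by (simp add: eval)
  also have "\<dots> \<le> (8 * poly p0 (1/3) + 2 * poly p0 (2/3)) + (8 * poly p2 (1/3) + 2 * poly p2 (2/3))"
    using SONC by (intro add_mono SONC_value_at_0_le)
  also have "\<dots> \<le> 12 * poly f (1/3) + 6 * poly f (2/3)"
    unfolding eval
    using SONC[THEN SONC_nonneg, of "1/3"] SONC[THEN SONC_nonneg, of "2/3"] by simp
  finally show False
    by (simp add: f power4_eq_xxxx)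
qed

end
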